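(* Let $N\ge 3$ be an integer, $\alpha=\pi/N$, and $d\in\mathbb{R}$ with $|d|<1$. For $t\in\mathbb{R}$ let $P=P(d,t)$ be the harmonic $N$-gon with consecutive vertices $w_1,\dots,w_N$ constructed in the context, and let $\theta_i$ be the internal angle of $P$ at $w_i$. Then for every integer $k>2$ with $N>k$, the sum $\sum_{i=1}^N\cot^k\theta_i$ is invariant over the family, that is, it does not depend on $t$.
   Context: Identify $\mathbb{R}^2$ with $\mathbb{C}$. Let $C$ be the unit circle centered at $0$. For $t\in\mathbb{R}$ put $z_k=e^{i(2\alpha k+t)}$, $k=1,\dots,N$ (indices modulo $N$); these are the vertices of a regular $N$-gon inscribed in $C$. For each $k$ let $w_k$ be the second intersection with $C$ of the line through $d$ and $z_k$, i.e. $w_k=\dfrac{d\bar z_k-1}{\bar z_k-d}$. The (convex, cyclic) polygon $P$ with consecutive vertices $w_1,\dots,w_N$ is the harmonic polygon associated with $d$ and $t$; for fixed $N,d$ the harmonic family is obtained by varying $t$. The internal angle $\theta_i\in(0,\pi)$ is $\angle w_{i-1}w_iw_{i+1}$. *)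

theory Defs
  imports "HOL-Analysis.Analysis"
begin

(* Indices range over int; "modulo N" is automatic, see harmonic_vertex_periodic. *)
definition regular_vertex :: "nat \<Rightarrow> real \<Rightarrow> int \<Rightarrow> complex" where
  "regular_vertex N t k = (let \<alpha> = pi / real N in cis (2 * \<alpha> * of_int k + t))"

definition second_intersection :: "real \<Rightarrow> complex \<Rightarrow> complex" where
  "second_intersection d z = (of_real d * cnj z - 1) / (cnj z - of_real d)"

definition harmonic_vertex :: "nat \<Rightarrow> real \<Rightarrow> real \<Rightarrow> int \<Rightarrow> complex" where
  "harmonic_vertex N d t k = second_intersection d (regular_vertex N t k)"

definition angle_at :: "'a::real_inner \<Rightarrow> 'a \<Rightarrow> 'a \<Rightarrow> real" where
  "angle_at a b c = arccos (((a - b) \<bullet> (c - b)) / (norm (a - b) * norm (c - b)))"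

(* The polygon is convex, so its internal angle is the unoriented angle between adjacent sides. *)
definition internal_angle :: "nat \<Rightarrow> real \<Rightarrow> real \<Rightarrow> int \<Rightarrow> real" where
  "internal_angle N d t i =
     angle_at (harmonic_vertex N d t (i - 1)) (harmonic_vertex N d t i) (harmonic_vertex N d t (i + 1))"

lemma harmonic_vertex_periodic:
  assumes "N > 0"
  shows "harmonic_vertex N d t (k + int N) = harmonic_vertex N d t k"
proof -
  have "2 * (pi / real N) * of_int (k + int N) + t = (2 * (pi / real N) * of_int k + t) + 2 * pi"
    using assms by (simp add: field_simps)
  then have "regular_vertex N t (k + int N) = regular_vertex N t k"
    unfolding regular_vertex_def Let_def
    by (simp only: cis_mult[symmetric] cis_2pi mult_1_right)
  then show ?thesis by (simp add: harmonic_vertex_def)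
qed

lemma second_intersection_eq:
  assumes "norm z = 1" "\<bar>d\<bar> < 1"
  shows "second_intersection d z =
    of_real d - of_real ((1 - d\<^sup>2) / (norm (z - of_real d))\<^sup>2) * (z - of_real d)"
proof -
  have ne: "z \<noteq> of_real d" using assms by auto
  then have ne': "cnj z \<noteq> of_real d" by (metis complex_cnj_cnj complex_cnj_complex_of_real)
  have n: "complex_of_real ((norm (z - of_real d))\<^sup>2) = (z - of_real d) * (cnj z - of_real d)"
    using complex_norm_square[of "z - of_real d"] by simp
  have "of_real ((1 - d\<^sup>2) / (norm (z - of_real d))\<^sup>2) * (z - of_real d)
      = (1 - (of_real d)\<^sup>2) / (cnj z - of_real d)"
    unfolding of_real_divide n using ne by simp
  moreover have "second_intersection d z = of_real d - (1 - (of_real d)\<^sup>2) / (cnj z - of_real d)"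
    unfolding second_intersection_def using ne' by (simp add: field_simps power2_eq_square)
  ultimately show ?thesis by simp
qed

lemma second_intersection_correct:
  assumes z: "norm z = 1" and d: "\<bar>d\<bar> < 1"
  shows "sphere 0 1 \<inter> affine hull {of_real d, z} = {z, second_intersection d z}"
    and "second_intersection d z \<noteq> z"
proof -
  define D where "D = complex_of_real d"
  define r where "r = norm (z - D)"
  define s where "s = (1 - d\<^sup>2) / r\<^sup>2"
  have ne: "z \<noteq> D" using assms unfolding D_def by auto
  then have r: "r > 0" by (simp add: r_def)
  have d2: "d\<^sup>2 < 1" using d by (simp add: abs_square_less_1)
  then have s: "s > 0" using r by (simp add: s_def)
  have w: "second_intersection d z = D + (- s) *\<^sub>R (z - D)"
    using second_intersection_eq[OF z d] by (simp add: D_def s_def r_def scaleR_conv_of_real)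
  have inj: "D + u *\<^sub>R (z - D) = D + v *\<^sub>R (z - D) \<longleftrightarrow> u = v" for u v
    using ne by simp
  have hull: "affine hull {D, z} = range (\<lambda>u. D + u *\<^sub>R (z - D))"
    unfolding affine_hull_2_alt ..
  have sq: "(norm (D + u *\<^sub>R (z - D)))\<^sup>2 - 1 = r\<^sup>2 * ((u - 1) * (u + s))" for u
  proof -
    define q where "q = D \<bullet> (z - D)"
    have e: "(norm (D + u *\<^sub>R (z - D)))\<^sup>2 = d\<^sup>2 + 2 * u * q + u\<^sup>2 * r\<^sup>2" for u
    proof -
      have "D \<bullet> D = d\<^sup>2" using power2_norm_eq_inner[of D] by (simp add: D_def)
      moreover have "(z - D) \<bullet> (z - D) = r\<^sup>2" by (simp add: r_def power2_norm_eq_inner)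
      ultimately show ?thesis
        unfolding power2_norm_eq_inner inner_add_left inner_add_right inner_scaleR_left
          inner_scaleR_right q_def[symmetric] inner_commute[of "z - D" D]
        by (simp add: power2_eq_square algebra_simps)
    qed
    from e[of 1] have q: "2 * q = 1 - d\<^sup>2 - r\<^sup>2" using z by simp
    have rs: "r\<^sup>2 * s = 1 - d\<^sup>2" using r by (simp add: s_def)
    have "(norm (D + u *\<^sub>R (z - D)))\<^sup>2 - 1 = d\<^sup>2 + u * (2 * q) + u\<^sup>2 * r\<^sup>2 - 1"
      unfolding e by simp
    also have "\<dots> = r\<^sup>2 * (u\<^sup>2 - u) + (u - 1) * (1 - d\<^sup>2)"
      unfolding q by (simp add: algebra_simps)
    also have "\<dots> = r\<^sup>2 * ((u - 1) * (u + s))"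
      unfolding rs[symmetric] by (simp add: algebra_simps power2_eq_square)
    finally show ?thesis .
  qed
  have on: "D + u *\<^sub>R (z - D) \<in> sphere 0 1 \<longleftrightarrow> u = 1 \<or> u = - s" for u
  proof -
    have "D + u *\<^sub>R (z - D) \<in> sphere 0 1 \<longleftrightarrow> (norm (D + u *\<^sub>R (z - D)))\<^sup>2 - 1 = 0"
      by (simp add: abs_square_eq_1)
    then show ?thesis unfolding sq using r by auto
  qed
  have one: "z = D + 1 *\<^sub>R (z - D)" by simp
  show "sphere 0 1 \<inter> affine hull {of_real d, z} = {z, second_intersection d z}"
  proof -
    have "sphere 0 1 \<inter> range (\<lambda>u. D + u *\<^sub>R (z - D)) = {D + 1 *\<^sub>R (z - D), D + (- s) *\<^sub>R (z - D)}"
    proof -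
      have "S \<inter> range f = {f a, f b}" if "\<And>u. f u \<in> S \<longleftrightarrow> u = a \<or> u = b"
        for f :: "real \<Rightarrow> complex" and S a b
        using that[of a] that[of b] by (auto simp: that)
      from this[of "\<lambda>u. D + u *\<^sub>R (z - D)", OF on] show ?thesis .
    qed
    then show ?thesis unfolding D_def[symmetric] hull w one[symmetric] .
  qed
  show "second_intersection d z \<noteq> z"
    unfolding w using inj[of "- s" 1] s by auto
qed

end

theory Submission
  imports Defs
begin

text \<open>
  On the unit circle the second intersection is the Moebius map \<open>z \<mapsto> (d - z) / (1 - d z)\<close>. With
  \<open>q = cis (2 \<alpha>)\<close> and \<open>z = cis \<tau>\<close> the product of one side at a vertex with the conjugate of the
  other is a positive multiple of \<open>2 d cos \<tau> - cnj q - d\<^sup>2 q\<close>, so that the cotangent of the angle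
  is an affine function \<open>A + B cos \<tau>\<close> of \<open>cos \<tau>\<close>. Its \<open>k\<close>-th power is a trigonometric polynomial
  of degree at most \<open>k < N\<close>, and summation over the vertices of a regular \<open>N\<close>-gon kills all
  harmonics of order strictly between \<open>0\<close> and \<open>N\<close>.
\<close>

text \<open>The real part of \<open>(a - b) * cnj (c - b)\<close> is the inner product of the sides
  and its modulus the product of their lengths, so the cosine is \<open>Re s / norm s\<close> and
  \<open>K\<close> cancels. The angle is unoriented, its sine nonnegative, hence the absolute value
  of \<open>Im s\<close>.\<close>

lemma cot_angle_at_complex:
  fixes a b c s :: complex
  assumes eq: "(a - b) * cnj (c - b) = of_real K * s" and K: "K > 0" and s: "Im s \<noteq> 0"
  shows "cot (angle_at a b c) = Re s / \<bar>Im s\<bar>"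
proof -
  define x where "x = Re s / norm s"
  have s0: "norm s > 0" using s by auto
  have n2: "(norm s)\<^sup>2 = (Re s)\<^sup>2 + (Im s)\<^sup>2" by (rule cmod_power2)
  have "(a - b) \<bullet> (c - b) = Re ((a - b) * cnj (c - b))"
    by (simp add: inner_complex_def algebra_simps)
  moreover have "norm (a - b) * norm (c - b) = norm ((a - b) * cnj (c - b))"
    by (simp only: norm_mult complex_mod_cnj)
  ultimately have ang: "angle_at a b c = arccos x"
    unfolding angle_at_def eq x_def using K by (simp add: norm_mult)
  have x: "\<bar>x\<bar> \<le> 1"
    unfolding x_def using abs_Re_le_cmod[of s] s0 by simp
  have "1 - x\<^sup>2 = ((norm s)\<^sup>2 - (Re s)\<^sup>2) / (norm s)\<^sup>2"
    using s0 by (simp add: x_def power_divide diff_divide_distrib)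
  then have "1 - x\<^sup>2 = (Im s / norm s)\<^sup>2"
    unfolding n2 by (simp add: power_divide cmod_power2)
  then have "sqrt (1 - x\<^sup>2) = \<bar>Im s\<bar> / norm s" by simp
  then have "sin (arccos x) = \<bar>Im s\<bar> / norm s"
    using x by (simp add: sin_arccos_abs)
  moreover have "cos (arccos x) = Re s / norm s"
    using x by (simp add: cos_arccos_abs x_def)
  ultimately show ?thesis
    unfolding ang cot_def using s0 by simp
qed

lemma one_minus_real_mult_neq_0:
  fixes z :: complex
  assumes "norm z = 1" and "\<bar>d\<bar> < 1"
  shows "1 - of_real d * z \<noteq> 0"
proof
  assume "1 - of_real d * z = 0"
  then have "norm (of_real d * z) = 1" by simp
  with assms show False by (simp add: norm_mult)
qed

text \<open>Multiply numerator and denominator by \<open>z\<close> and use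
  \<open>z * cnj z = 1\<close>.\<close>

lemma second_intersection_moebius:
  assumes z: "norm z = 1"
  shows "second_intersection d z = (of_real d - z) / (1 - of_real d * z)"
proof -
  have zz: "z * cnj z = 1" using z complex_norm_square[of z] by simp
  have "z * (cnj z - of_real d) = 1 - of_real d * z"
    "z * (of_real d * cnj z - 1) = of_real d - z"
    using zz by (algebra)+
  moreover have "z \<noteq> 0" using z by auto
  ultimately show ?thesis
    unfolding second_intersection_def by (metis mult_divide_mult_cancel_left)
qed

text \<open>The usual difference formula for a Moebius map, here with determinant d^2 - 1.\<close>

lemma second_intersection_diff:
  assumes "norm z = 1" "norm z' = 1" "\<bar>d\<bar> < 1"
  shows "second_intersection d z - second_intersection d z' =
    (1 - (of_real d)\<^sup>2) * (z' - z) / ((1 - of_real d * z) * (1 - of_real d * z'))"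
proof -
  have "1 - of_real d * z \<noteq> 0" "1 - of_real d * z' \<noteq> 0"
    by (rule one_minus_real_mult_neq_0[OF _ assms(3)], fact)+
  then have "second_intersection d z - second_intersection d z' =
      ((of_real d - z) * (1 - of_real d * z') - (of_real d - z') * (1 - of_real d * z))
        / ((1 - of_real d * z) * (1 - of_real d * z'))"
    unfolding assms(1,2)[THEN second_intersection_moebius]
    by (rule diff_frac_eq)
  moreover have "(of_real d - z) * (1 - of_real d * z') - (of_real d - z') * (1 - of_real d * z) =
      (1 - (of_real d)\<^sup>2) * (z' - z)"
    by algebra
  ultimately show ?thesis by simp
qed

text \<open>Both sides share the vertex \<open>w z\<close>, so its denominator contributes a squared
  modulus. The denominators of the two neighbours do not pair up; making them real leaves a
  numerator that, with the factor \<open>- cnj q\<close> from the chord differences, expands to the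
  bracket.\<close>

lemma sides_product:
  fixes q z :: complex and d :: real
  assumes q: "norm q = 1" "q \<noteq> 1" and z: "norm z = 1" and d: "\<bar>d\<bar> < 1"
  defines "w \<equiv> second_intersection d"
  obtains K where "K > 0" and "(w (z * cnj q) - w z) * cnj (w (z * q) - w z) =
    of_real K * (of_real (2 * d * Re z) - cnj q - (of_real d)\<^sup>2 * q)"
proof -
  define D where "D = complex_of_real d"
  define E where "E = 1 - D\<^sup>2"
  \<comment> \<open>The conjugates get names of their own so that the identities below become
    polynomial consequences of \<open>q * q1 = 1\<close> and \<open>z * z1 = 1\<close>.\<close>
  define z1 q1 where "z1 = cnj z" and "q1 = cnj q"
  define a b c where "a = 1 - D * z" and "b = 1 - D * (z * q1)" and "c = 1 - D * (z * q)"
  \<comment> \<open>\<open>K\<close> collects all squared moduli; what remains of the product is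
    \<open>- q1 * (cnj b * c)\<close>.\<close>
  define K where "K = ((1 - d\<^sup>2) * norm (1 - q) / (norm a * norm b * norm c))\<^sup>2"
  have qq: "q * q1 = 1" using q complex_norm_square[of q] by (simp add: q1_def)
  have zz: "z * z1 = 1" using z complex_norm_square[of z] by (simp add: z1_def)
  have abc: "a \<noteq> 0" "b \<noteq> 0" "c \<noteq> 0"
    unfolding a_def b_def c_def D_def q1_def
    by (rule one_minus_real_mult_neq_0; use q z d in \<open>simp add: norm_mult\<close>)+
  have "d\<^sup>2 < 1" using d by (simp add: abs_square_less_1)
  then have K: "K > 0" using abc q(2) by (auto simp: K_def)
  have conj: "cnj z = z1" "cnj q = q1" "cnj D = D" "cnj E = E" "cnj z1 = z" "cnj q1 = q"
    by (simp_all add: z1_def q1_def D_def E_def)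
  have cb: "cnj b = 1 - D * (z1 * q)"
    by (simp add: b_def conj)
  have d1: "w (z * cnj q) - w z = E * (z - z * q1) / (b * a)"
    unfolding w_def using q z d
    by (subst second_intersection_diff)
       (simp_all add: norm_mult E_def D_def a_def b_def q1_def)
  have "w (z * q) - w z = E * (z - z * q) / (c * a)"
    unfolding w_def using q z d
    by (subst second_intersection_diff)
       (simp_all add: norm_mult E_def D_def a_def c_def)
  then have d2: "cnj (w (z * q) - w z) = E * (z1 - z1 * q1) / (cnj c * cnj a)"
    by (simp only: complex_cnj_divide complex_cnj_mult complex_cnj_diff conj)
  have Kc: "of_real K = E\<^sup>2 * ((1 - q) * (1 - q1)) / ((a * cnj a) * (b * cnj b) * (c * cnj c))"
    unfolding K_def power_mult_distrib power_divide of_real_mult of_real_divide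
      complex_norm_square
    by (simp add: E_def D_def q1_def)
  have key: "(z - z * q1) * (z1 - z1 * q1) = - q1 * ((1 - q) * (1 - q1))"
    using qq zz by algebra
  have re: "of_real (2 * d * Re z) = D * (z + z1)"
    by (simp add: complex_add_cnj z1_def D_def)
  have fac: "- q1 * (cnj b * c) = D * (z + z1) - q1 - D\<^sup>2 * q"
    unfolding cb c_def using qq zz by algebra
  have "(w (z * cnj q) - w z) * cnj (w (z * q) - w z) =
      E\<^sup>2 * ((z - z * q1) * (z1 - z1 * q1)) / (a * cnj a * b * cnj c)"
    unfolding d1 d2 by (simp add: power2_eq_square mult_ac)
  also have "\<dots> = of_real K * (- q1 * (cnj b * c))"
    unfolding key Kc using abc by (simp add: field_simps)
  also have "\<dots> = of_real K * (of_real (2 * d * Re z) - cnj q - (of_real d)\<^sup>2 * q)"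
    unfolding fac re D_def[symmetric] conj ..
  finally show ?thesis using K that by blast
qed

lemma cot_internal_angle:
  assumes N: "N \<ge> 3" and d: "\<bar>d\<bar> < 1"
  shows "cot (internal_angle N d t i) =
    (2 * d * cos (2 * pi / real N * of_int i + t) - (1 + d\<^sup>2) * cos (2 * pi / real N))
      / ((1 - d\<^sup>2) * sin (2 * pi / real N))"
proof -
  define \<beta> where "\<beta> = 2 * pi / real N"
  define z q where "z = regular_vertex N t i" and "q = cis \<beta>"
  have v: "z = cis (\<beta> * of_int i + t)"
    by (simp add: z_def regular_vertex_def \<beta>_def)
  have z1: "regular_vertex N t (i + 1) = z * q"
    unfolding v q_def regular_vertex_def Let_def cis_mult
    by (rule arg_cong[where f = cis]) (simp add: \<beta>_def algebra_simps add_divide_distrib)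
  have z2: "regular_vertex N t (i - 1) = z * cnj q"
    unfolding v q_def regular_vertex_def Let_def cis_cnj cis_mult
    by (rule arg_cong[where f = cis]) (simp add: \<beta>_def algebra_simps diff_divide_distrib)
  \<comment> \<open>Here \<open>N \<ge> 3\<close> enters: it makes \<open>sin \<beta>\<close> and
    then \<open>Im s\<close> positive, so the absolute value in the cotangent formula drops
    out.\<close>
  have "0 < \<beta>" "\<beta> < pi" using N by (auto simp: \<beta>_def field_simps)
  then have sin: "sin \<beta> > 0" by (rule sin_gt_zero)
  have d2: "d\<^sup>2 < 1" using d by (simp add: abs_square_less_1)
  have "q \<noteq> 1" using sin by (auto simp: q_def complex_eq_iff)
  then obtain K where K: "K > 0" and
    "(second_intersection d (z * cnj q) - second_intersection d z) *
      cnj (second_intersection d (z * q) - second_intersection d z) =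
      of_real K * (of_real (2 * d * Re z) - cnj q - (of_real d)\<^sup>2 * q)"
    using sides_product[of q z d] d by (auto simp: q_def v)
  moreover define s where "s = of_real (2 * d * Re z) - cnj q - (of_real d)\<^sup>2 * q"
  moreover have im: "Im s = (1 - d\<^sup>2) * sin \<beta>"
    by (simp add: s_def q_def algebra_simps flip: of_real_power)
  moreover have "Re s = 2 * d * cos (\<beta> * of_int i + t) - (1 + d\<^sup>2) * cos \<beta>"
    by (simp add: s_def q_def v algebra_simps flip: of_real_power)
  moreover have "Im s > 0" unfolding im using sin d2 by simp
  ultimately show ?thesis
    unfolding internal_angle_def harmonic_vertex_def z1 z2 z_def[symmetric] \<beta>_def[symmetric]
    by (subst cot_angle_at_complex[of _ _ _ K s]) auto
qed

text \<open>The sum is the real part of a geometric sum whose ratio \<open>r\<close> is an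
  \<open>N\<close>-th root of unity, and \<open>r\<close> is not 1 because \<open>N\<close> does not
  divide \<open>m\<close>.\<close>

lemma sum_cos_regular_eq_0:
  fixes m :: int
  assumes "m \<noteq> 0" and "\<bar>m\<bar> < int N"
  shows "(\<Sum>i = 1..int N. cos (of_int m * (2 * pi / real N * of_int i + t))) = 0"
proof -
  have N: "N > 0" using assms by auto
  define r where "r = cis (2 * pi * of_int m / real N)"
  have "r \<noteq> 1"
  proof
    assume "r = 1"
    then have "cos (2 * pi * of_int m / real N) = 1"
      by (simp add: r_def complex_eq_iff)
    then obtain n :: int where "2 * pi * of_int m / real N = of_int n * 2 * pi"
      unfolding cos_one_2pi_int by blast
    then have "real_of_int m = of_int (n * int N)"
      using N by (simp add: field_simps)
    then have "m = n * int N" by linarith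
    then have "int N dvd m" by simp
    with assms show False using zdvd_imp_le[of "int N" "\<bar>m\<bar>"] by auto
  qed
  have "r ^ N = 1"
  proof -
    have "r ^ N = cis (2 * pi * of_int m)"
      unfolding r_def Complex.DeMoivre by (rule arg_cong[where f = cis]) (use N in simp)
    then show ?thesis by (simp add: cis_multiple_2pi)
  qed
  have "(\<Sum>i = 1..int N. cis (of_int m * (2 * pi / real N * of_int i + t)))
      = (\<Sum>j = 1..N. cis (of_int m * (2 * pi / real N * real j + t)))"
    by (rule sum.reindex_bij_witness[of _ int nat]) auto
  also have "\<dots> = (\<Sum>j = 1..N. cis (of_int m * t) * r ^ j)"
    by (intro sum.cong refl)
       (simp add: r_def Complex.DeMoivre cis_mult, simp add: algebra_simps)
  also have "\<dots> = (\<Sum>j<N. cis (of_int m * t) * r ^ Suc j)"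
    by (rule sum.reindex_bij_witness[of _ Suc "\<lambda>j. j - 1"]) auto
  also have "\<dots> = cis (of_int m * t) * r * (\<Sum>j<N. r ^ j)"
    by (simp add: sum_distrib_left mult_ac)
  also have "(\<Sum>j<N. r ^ j) = 0"
    using \<open>r \<noteq> 1\<close> \<open>r ^ N = 1\<close> by (simp add: geometric_sum)
  finally have "Re (\<Sum>i = 1..int N. cis (of_int m * (2 * pi / real N * of_int i + t))) = 0"
    by simp
  then show ?thesis by simp
qed

text \<open>The additional factor \<open>cos (m \<tau>)\<close> lets the induction on \<open>k\<close> close up through the product
  formula for cosines, without expanding the power into harmonics.\<close>

lemma sum_affine_cos_power_regular_constant:
  fixes m :: int
  assumes "int k + \<bar>m\<bar> < int N"
  shows "\<exists>c. \<forall>t. (\<Sum>i = 1..int N. (A + B * cos (2 * pi / real N * of_int i + t)) ^ k *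
    cos (of_int m * (2 * pi / real N * of_int i + t))) = c"
  using assms
proof (induction k arbitrary: m)
  case 0
  show ?case
  \<comment> \<open>For \<open>m = 0\<close> every summand is 1; otherwise the sum vanishes.\<close>
  proof (cases "m = 0")
    case False
    with 0 show ?thesis using sum_cos_regular_eq_0[of m N] by simp
  qed simp
next
  case (Suc k)
  define \<tau> where "\<tau> t i = 2 * pi / real N * of_int i + t" for t :: real and i :: int
  define S where "S m t = (\<Sum>i = 1..int N. (A + B * cos (\<tau> t i)) ^ k * cos (of_int m * \<tau> t i))"
    for m :: int and t
  have const: "\<exists>c. \<forall>t. S j t = c" if "int k + \<bar>j\<bar> < int N" for j
    using Suc.IH[OF that] by (simp add: S_def \<tau>_def)
  obtain c0 c1 c2 where c: "\<And>t. S m t = c0" "\<And>t. S (m + 1) t = c1" "\<And>t. S (m - 1) t = c2"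
    using const[of m] const[of "m + 1"] const[of "m - 1"] Suc.prems by fastforce
  \<comment> \<open>The product formula for \<open>cos x * cos (m * x)\<close> lowers the exponent
    by one and changes \<open>m\<close> by at most one, so the bound on
    \<open>k + \<bar>m\<bar>\<close> is inherited.\<close>
  have "(A + B * cos x) ^ Suc k * cos (of_int m * x) =
      A * ((A + B * cos x) ^ k * cos (of_int m * x)) +
      B / 2 * ((A + B * cos x) ^ k * cos (of_int (m + 1) * x)) +
      B / 2 * ((A + B * cos x) ^ k * cos (of_int (m - 1) * x))" for x :: real
    by (simp add: algebra_simps cos_add cos_diff)
  then have "(\<Sum>i = 1..int N. (A + B * cos (\<tau> t i)) ^ Suc k * cos (of_int m * \<tau> t i)) =
      A * S m t + B / 2 * S (m + 1) t + B / 2 * S (m - 1) t" for t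
    unfolding S_def by (simp only: sum.distrib sum_distrib_left)
  then show ?case unfolding c \<tau>_def by blast
qed

theorem mainTheorem6:
  fixes N k :: nat and d :: real
  assumes "N \<ge> 3" and "\<bar>d\<bar> < 1" and "k > 2" and "N > k"
  shows "\<exists>c. \<forall>t. (\<Sum>i = 1..int N. cot (internal_angle N d t i) ^ k) = c"
proof -
  define M where "M = (1 - d\<^sup>2) * sin (2 * pi / real N)"
  have "cot (internal_angle N d t i) =
      - ((1 + d\<^sup>2) * cos (2 * pi / real N) / M) + 2 * d / M * cos (2 * pi / real N * of_int i + t)"
    for t i
    unfolding cot_internal_angle[OF assms(1,2)] M_def[symmetric]
    by (simp add: diff_divide_distrib)
  \<comment> \<open>With \<open>m = 0\<close> the auxiliary cosine is 1 and the degree bound becomes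
    \<open>k < N\<close>.\<close>
  then show ?thesis
    using sum_affine_cos_power_regular_constant[of k 0 N] assms(4)
    by (simp only: of_int_0 mult_zero_left cos_zero mult_1_right abs_zero add_0_right of_nat_less_iff)
qed

end
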